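(* Let $\lambda$ be a weight of $\mathfrak{sl}(n+1)$, $\lambda_i=(\lambda,\alpha_i)$, $i=1,\dots,n$. The function $$\Phi_n(\lambda,\kappa)(t_1,\dots,t_n)=t_1^{-\lambda_1/\kappa}(1-t_1)^{-1/\kappa}\prod_{j=2}^n t_j^{-\lambda_j/\kappa}(t_j-t_{j-1})^{-1/\kappa}$$ has exactly one critical point $t^n=(t^n_1,\dots,t^n_n)$, given by $$t^n_j(\lambda_1,\dots,\lambda_n)=\prod_{i=1}^j\frac{\lambda_i+\dots+\lambda_n+n-i}{\lambda_i+\dots+\lambda_n+n-i+1},\qquad j=1,\dots,n.$$
   Context: Here $\alpha_1,\dots,\alpha_n$ are the simple roots of $\mathfrak{sl}(n+1)$ and $\kappa$ is the (nonzero) parameter of the Knizhnik–Zamolodchikov (KZ) equation. A critical point of the multivalued function $\Phi_n(\lambda,\kappa)$ is a solution $t=(t_1,\dots,t_n)$ of the equation $d\Phi_n=0$ (the Bethe equation), that is, of the system $\frac{\partial}{\partial t_j}\ln\Phi_n(\lambda,\kappa)=0$, $j=1,\dots,n$, where $\ln\Phi_n(\lambda,\kappa)=-\frac1\kappa\big(\ln(1-t_1)+\sum_{j=1}^n\lambda_j\ln t_j+\sum_{j=2}^n\ln(t_j-t_{j-1})\big)$. Origin of the function: $\Phi_n(\lambda,\kappa)$ is the normalized phase function used in the hypergeometric solutions of the KZ equation with values in the tensor product of the Verma module of highest weight $\lambda$ and the linear representation of $\mathfrak{sl}(n+1)$ (irreducible, with highest weight $\omega$, $(\omega,\alpha_i)=\delta_{i,1}$),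 for singular vectors of weight $\lambda+\omega-\sum_{i=1}^n\alpha_i$.
   Formalization: Assumes in addition that λ_i+…+λ_n+n−i and λ_i+…+λ_n+n−i+1 are nonzero for all i=1,…,n; otherwise the formula is undefined or gives no critical point (e.g. n=1, λ_1=0 has none). *)

theory Defs
  imports "HOL-Complex_Analysis.Complex_Analysis" "HOL-Library.FuncSet"
begin

text \<open>
  Weights of sl(n+1) are complex linear forms on the diagonal Cartan subalgebra. They are written in
  the coordinates given by the matrix-entry functionals, normalised to have coordinate sum 0; the
  invariant bilinear form, normalised by giving every root square length 2, is then the dot product.
\<close>

definition sl_weight :: "nat \<Rightarrow> (nat \<Rightarrow> complex) \<Rightarrow> bool" where
  "sl_weight n \<Lambda> \<longleftrightarrow> \<Lambda> \<in> extensional {1..n+1} \<and> (\<Sum>k=1..n+1. \<Lambda> k) = 0"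

definition weight_form :: "nat \<Rightarrow> (nat \<Rightarrow> complex) \<Rightarrow> (nat \<Rightarrow> complex) \<Rightarrow> complex" where
  "weight_form n \<Lambda> \<mu> = (\<Sum>k=1..n+1. \<Lambda> k * \<mu> k)"

definition simple_root :: "nat \<Rightarrow> nat \<Rightarrow> nat \<Rightarrow> complex" where
  "simple_root n i = (\<lambda>k\<in>{1..n+1}. if k = i then 1 else if k = i + 1 then -1 else 0)"

definition log_branch_at :: "complex \<Rightarrow> (complex \<Rightarrow> complex) \<Rightarrow> bool" where
  "log_branch_at w l \<longleftrightarrow>
     (\<exists>V. open V \<and> w \<in> V \<and> l holomorphic_on V \<and> (\<forall>z\<in>V. exp (l z) = z))"

definition branch_power :: "(complex \<Rightarrow> complex) \<Rightarrow> complex \<Rightarrow> complex \<Rightarrow> complex" where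
  "branch_power l a z = exp (a * l z)"

text \<open>
  A local branch of the multivalued phase function is given by a branch of the logarithm for each
  of its factors: \<open>p\<close> for \<open>1 - t 1\<close>, \<open>q j\<close> for \<open>t j\<close>, and \<open>r j\<close> for \<open>t j - t (j - 1)\<close>. Principal
  branches would not do, since \<open>t j - t (j - 1)\<close> may well be a negative real at the critical point.
  Points of complex n-space are functions extensional on \<open>{1..n}\<close>, so that
  equality of points is equality of their n coordinates.
\<close>

definition phase_domain :: "nat \<Rightarrow> (nat \<Rightarrow> complex) set" where
  "phase_domain n = {t \<in> extensional {1..n}.
     t 1 \<noteq> 1 \<and> (\<forall>j\<in>{1..n}. t j \<noteq> 0) \<and> (\<forall>j\<in>{2..n}. t j \<noteq> t (j - 1))}"

definition phase_branch_at ::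
  "nat \<Rightarrow> (complex \<Rightarrow> complex) \<Rightarrow> (nat \<Rightarrow> complex \<Rightarrow> complex) \<Rightarrow> (nat \<Rightarrow> complex \<Rightarrow> complex)
     \<Rightarrow> (nat \<Rightarrow> complex) \<Rightarrow> bool" where
  "phase_branch_at n p q r t \<longleftrightarrow>
     log_branch_at (1 - t 1) p \<and>
     (\<forall>j\<in>{1..n}. log_branch_at (t j) (q j)) \<and>
     (\<forall>j\<in>{2..n}. log_branch_at (t j - t (j - 1)) (r j))"

definition phase ::
  "nat \<Rightarrow> (nat \<Rightarrow> complex) \<Rightarrow> complex \<Rightarrow> (complex \<Rightarrow> complex) \<Rightarrow> (nat \<Rightarrow> complex \<Rightarrow> complex)
     \<Rightarrow> (nat \<Rightarrow> complex \<Rightarrow> complex) \<Rightarrow> (nat \<Rightarrow> complex) \<Rightarrow> complex" where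
  "phase n lam \<kappa> p q r t =
     branch_power (q 1) (- lam 1 / \<kappa>) (t 1) * branch_power p (- 1 / \<kappa>) (1 - t 1) *
     (\<Prod>j=2..n. branch_power (q j) (- lam j / \<kappa>) (t j) *
                branch_power (r j) (- 1 / \<kappa>) (t j - t (j - 1)))"

definition ln_phase ::
  "nat \<Rightarrow> (nat \<Rightarrow> complex) \<Rightarrow> complex \<Rightarrow> (complex \<Rightarrow> complex) \<Rightarrow> (nat \<Rightarrow> complex \<Rightarrow> complex)
     \<Rightarrow> (nat \<Rightarrow> complex \<Rightarrow> complex) \<Rightarrow> (nat \<Rightarrow> complex) \<Rightarrow> complex" where
  "ln_phase n lam \<kappa> p q r t =
     - (1 / \<kappa>) * (p (1 - t 1) + (\<Sum>j=1..n. lam j * q j (t j)) + (\<Sum>j=2..n. r j (t j - t (j - 1))))"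

text \<open>
  Two local branches of \<open>ln_phase\<close> differ by a constant near the point, so quantifying over all
  branches is the same as choosing one.
\<close>

definition phase_critical_point ::
  "nat \<Rightarrow> (nat \<Rightarrow> complex) \<Rightarrow> complex \<Rightarrow> (nat \<Rightarrow> complex) \<Rightarrow> bool" where
  "phase_critical_point n lam \<kappa> t \<longleftrightarrow>
     t \<in> phase_domain n \<and>
     (\<forall>p q r. phase_branch_at n p q r t \<longrightarrow>
        (\<forall>j\<in>{1..n}. ((\<lambda>z. ln_phase n lam \<kappa> p q r (t(j := z))) has_field_derivative 0) (at (t j))))"

text \<open>
  If a numerator or a denominator below vanishes, the formula leaves \<open>phase_domain\<close> or divides
  by 0; for such weights there is no critical point at all.
\<close>

definition bethe_point :: "nat \<Rightarrow> (nat \<Rightarrow> complex) \<Rightarrow> nat \<Rightarrow> complex" where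
  "bethe_point n lam = (\<lambda>j\<in>{1..n}.
     \<Prod>i=1..j. ((\<Sum>k=i..n. lam k) + of_nat n - of_nat i) / ((\<Sum>k=i..n. lam k) + of_nat n - of_nat i + 1))"

lemma phase_eq_exp_ln_phase:
  assumes "n \<ge> 1"
  shows "phase n lam \<kappa> p q r t = exp (ln_phase n lam \<kappa> p q r t)"
proof -
  have *: "(\<Sum>j=1..n. lam j * q j (t j)) = lam 1 * q 1 (t 1) + (\<Sum>j=2..n. lam j * q j (t j))"
    using assms sum.atLeast_Suc_atMost[of 1 n "\<lambda>j. lam j * q j (t j)"]
    by (simp add: numeral_2_eq_2)
  have "exp (ln_phase n lam \<kappa> p q r t) =
      exp (- lam 1 / \<kappa> * q 1 (t 1) + - 1 / \<kappa> * p (1 - t 1) +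
        (\<Sum>j=2..n. - lam j / \<kappa> * q j (t j) + - 1 / \<kappa> * r j (t j - t (j - 1))))"
    unfolding ln_phase_def * sum.distrib
    by (simp add: sum_distrib_left sum_negf algebra_simps)
  also have "\<dots> = phase n lam \<kappa> p q r t"
    unfolding phase_def branch_power_def by (simp only: exp_add exp_sum finite_atLeastAtMost)
  finally show ?thesis by simp
qed

lemma log_branch_exists:
  assumes "w \<noteq> 0"
  shows "\<exists>l. log_branch_at w l"
proof -
  obtain l where "l holomorphic_on ball w (norm w)" "\<And>z. z \<in> ball w (norm w) \<Longrightarrow> z = exp (l z)"
  proof (rule contractible_imp_holomorphic_log[of "\<lambda>z. z" "ball w (norm w)"])
    show "contractible (ball w (norm w))"
      by (simp add: convex_imp_contractible)
  qed (auto simp: dist_norm intro: holomorphic_intros)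
  with assms show ?thesis
    unfolding log_branch_at_def by (intro exI[of _ l] exI[of _ "ball w (norm w)"]) auto
qed

lemma phase_branch_exists:
  assumes "t \<in> phase_domain n"
  shows "\<exists>p q r. phase_branch_at n p q r t"
proof -
  have "\<exists>p. log_branch_at (1 - t 1) p"
    using assms by (intro log_branch_exists) (simp add: phase_domain_def)
  moreover have "\<forall>j\<in>{1..n}. \<exists>l. log_branch_at (t j) l"
    using assms by (intro ballI log_branch_exists) (simp add: phase_domain_def)
  then obtain q where "\<forall>j\<in>{1..n}. log_branch_at (t j) (q j)" by metis
  moreover have "\<forall>j\<in>{2..n}. \<exists>l. log_branch_at (t j - t (j - 1)) l"
    using assms by (intro ballI log_branch_exists) (simp add: phase_domain_def)
  then obtain r where "\<forall>j\<in>{2..n}. log_branch_at (t j - t (j - 1)) (r j)" by metis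
  ultimately show ?thesis unfolding phase_branch_at_def by blast
qed

lemma log_branch_differentiable:
  assumes "log_branch_at w l" "f field_differentiable (at z)" "f z = w"
  shows "(\<lambda>x. l (f x)) field_differentiable (at z)"
proof -
  have "l field_differentiable (at (f z))"
    using assms(1,3) holomorphic_on_imp_differentiable_at unfolding log_branch_at_def by blast
  from field_differentiable_compose[OF assms(2) this] show ?thesis by (simp add: o_def)
qed

lemma ln_phase_partial_differentiable:
  assumes "phase_branch_at n p q r t"
  shows "(\<lambda>z. ln_phase n lam \<kappa> p q r (t(j := z))) field_differentiable (at (t j))"
proof -
  have c: "(\<lambda>z. (t(j := z)) i) field_differentiable (at (t j))" for i
    by (cases "i = j") auto
  note b = assms[unfolded phase_branch_at_def]
  have "(\<lambda>z. p (1 - (t(j := z)) 1)) field_differentiable (at (t j))"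
  proof (rule log_branch_differentiable[where f = "\<lambda>z. 1 - (t(j := z)) 1"])
    show "log_branch_at (1 - t 1) p" using b by blast
    show "(\<lambda>z. 1 - (t(j := z)) 1) field_differentiable (at (t j))"
      by (rule field_differentiable_diff[OF field_differentiable_const c])
  qed simp
  moreover have "(\<lambda>z. q i ((t(j := z)) i)) field_differentiable (at (t j))"
    if "i \<in> {1..n}" for i
  proof (rule log_branch_differentiable[where f = "\<lambda>z. (t(j := z)) i"])
    show "log_branch_at (t i) (q i)" using b that by blast
    show "(\<lambda>z. (t(j := z)) i) field_differentiable (at (t j))" by (rule c)
  qed simp
  moreover have "(\<lambda>z. r i ((t(j := z)) i - (t(j := z)) (i - 1))) field_differentiable (at (t j))"
    if "i \<in> {2..n}" for i
  proof (rule log_branch_differentiable[where f = "\<lambda>z. (t(j := z)) i - (t(j := z)) (i - 1)"])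
    show "log_branch_at (t i - t (i - 1)) (r i)" using b that by blast
    show "(\<lambda>z. (t(j := z)) i - (t(j := z)) (i - 1)) field_differentiable (at (t j))"
      by (rule field_differentiable_diff[OF c c])
  qed simp
  ultimately show ?thesis
    unfolding ln_phase_def
    by (intro field_differentiable_mult[OF field_differentiable_const]
        field_differentiable_add field_differentiable_sum)
qed

lemma ln_phase_partial_zero_iff:
  assumes "n \<ge> 1" "phase_branch_at n p q r t"
  shows "((\<lambda>z. ln_phase n lam \<kappa> p q r (t(j := z))) has_field_derivative 0) (at (t j)) \<longleftrightarrow>
         ((\<lambda>z. phase n lam \<kappa> p q r (t(j := z))) has_field_derivative 0) (at (t j))"
proof -
  let ?L = "\<lambda>z. ln_phase n lam \<kappa> p q r (t(j := z))"
  obtain D where D: "(?L has_field_derivative D) (at (t j))"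
    using ln_phase_partial_differentiable[OF assms(2)] unfolding field_differentiable_def by blast
  have E: "((\<lambda>z. phase n lam \<kappa> p q r (t(j := z))) has_field_derivative exp (?L (t j)) * D) (at (t j))"
    unfolding phase_eq_exp_ln_phase[OF assms(1)] by (rule DERIV_chain2[OF DERIV_exp D])
  show ?thesis
    using D E by (metis DERIV_unique exp_not_eq_zero mult_eq_0_iff)
qed

lemma weight_form_simple_root:
  assumes "i \<in> {1..n}"
  shows "weight_form n \<Lambda> (simple_root n i) = \<Lambda> i - \<Lambda> (i + 1)"
proof -
  have "weight_form n \<Lambda> (simple_root n i) =
      (\<Sum>k=1..n+1. (if k = i then \<Lambda> k else 0) + (if k = i + 1 then - \<Lambda> k else 0))"
    unfolding weight_form_def simple_root_def by (rule sum.cong) auto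
  also have "\<dots> = \<Lambda> i - \<Lambda> (i + 1)"
    using assms by (simp add: sum.distrib del: sum.cl_ivl_Suc)
  finally show ?thesis .
qed

lemma sl_weight_exists:
  "\<exists>\<Lambda>. sl_weight n \<Lambda> \<and> (\<forall>i\<in>{1..n}. weight_form n \<Lambda> (simple_root n i) = lam i)"
proof -
  define c where "c = (\<Sum>k=1..n+1. \<Sum>i=k..n. lam i) / of_nat (n + 1)"
  define \<Lambda> where "\<Lambda> = (\<lambda>k\<in>{1..n+1}. (\<Sum>i=k..n. lam i) - c)"
  have "(\<Sum>k=1..n+1. \<Lambda> k) = (\<Sum>k=1..n+1. (\<Sum>i=k..n. lam i) - c)"
    unfolding \<Lambda>_def by (rule sum.cong) auto
  also have "\<dots> = (\<Sum>k=1..n+1. \<Sum>i=k..n. lam i) - of_nat (n + 1) * c"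
    by (simp add: sum_subtractf del: sum.cl_ivl_Suc)
  also have "\<dots> = 0"
    unfolding c_def by (simp del: sum.cl_ivl_Suc of_nat_add of_nat_Suc)
  finally have "sl_weight n \<Lambda>"
    unfolding sl_weight_def by (simp add: \<Lambda>_def)
  moreover have "weight_form n \<Lambda> (simple_root n i) = lam i" if "i \<in> {1..n}" for i
  proof -
    have "(\<Sum>k=i..n. lam k) = lam i + (\<Sum>k=Suc i..n. lam k)"
      using that by (intro sum.atLeast_Suc_atMost) auto
    then show ?thesis
      unfolding weight_form_simple_root[OF that] using that by (simp add: \<Lambda>_def)
  qed
  ultimately show ?thesis by blast
qed

end

theory Submission imports Defs begin

text \<open>
  Put \<open>t 0 = 1\<close> and \<open>u j = t j / (t j - t (j - 1))\<close>. Multiplying the j-th Bethe equation by \<open>t j\<close>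
  turns the system into the linear recursion \<open>u j + lam j = u (j + 1) - 1\<close> for \<open>j < n\<close>, with
  \<open>u n + lam n = 0\<close>. It is solved downwards from \<open>n\<close> by \<open>u j = - s j\<close>, where
  \<open>s j = lam j + \<dots> + lam n + n - j\<close>; this says \<open>t j = t (j - 1) * s j / (s j + 1)\<close>, which is solved
  upwards from \<open>t 0 = 1\<close>.
\<close>

text \<open>Differentiating \<open>exp (l z) = z\<close> at \<open>w\<close> gives
  \<open>w * D = 1\<close>, so every branch has derivative \<open>1 / w\<close>. The result does not
  depend on the branch, and \<open>w\<close> is nonzero automatically.\<close>

lemma log_branch_compose_derivative:
  assumes l: "log_branch_at w l" and f: "(f has_field_derivative f') (at z)" and w: "f z = w"
  shows "((\<lambda>x. l (f x)) has_field_derivative f' / w) (at z)"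
proof -
  obtain V where V: "open V" "w \<in> V" "l holomorphic_on V" "\<And>z. z \<in> V \<Longrightarrow> exp (l z) = z"
    using l unfolding log_branch_at_def by blast
  obtain D where D: "(l has_field_derivative D) (at w)"
    using holomorphic_on_imp_differentiable_at[OF V(3,1,2)]
    unfolding field_differentiable_def by blast
  have "((\<lambda>z. exp (l z)) has_field_derivative exp (l w) * D) (at w)"
    by (rule DERIV_chain2[OF DERIV_exp D])
  moreover have "((\<lambda>z. exp (l z)) has_field_derivative 1) (at w)"
    by (rule has_field_derivative_transform_within_open[OF DERIV_ident V(1,2)]) (simp add: V(4))
  ultimately have "w * D = 1"
    using V(2,4) DERIV_unique by metis
  then have "D = 1 / w"
    by (metis mult_zero_left nonzero_mult_div_cancel_left zero_neq_one)
  with DERIV_chain2[of l D f z f' UNIV] D f w show ?thesis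
    by simp
qed

text \<open>Index 0 lies outside \<open>{1..n}\<close>, so its slot is free to hold the constant 1.
  The factor \<open>1 - t 1\<close> then becomes, up to sign, one more consecutive difference, and
  the first Bethe equation takes the shape of the others.\<close>

definition with_base :: "(nat \<Rightarrow> complex) \<Rightarrow> nat \<Rightarrow> complex" where
  "with_base t = t(0 := 1)"

text \<open>The j-th logarithmic derivative of the phase function without its factor
  \<open>- (1 / \<kappa>)\<close>. The last term comes from the next difference, which does not
  exist for \<open>j = n\<close>.\<close>

definition bethe_lhs :: "nat \<Rightarrow> (nat \<Rightarrow> complex) \<Rightarrow> (nat \<Rightarrow> complex) \<Rightarrow> nat \<Rightarrow> complex" where
  "bethe_lhs n lam T j = lam j / T j + 1 / (T j - T (j - 1)) -
     (if j < n then 1 / (T (Suc j) - T j) else 0)"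

lemma ln_phase_partial_derivative:
  assumes b: "phase_branch_at n p q r t" and j: "j \<in> {1..n}"
  shows "((\<lambda>z. ln_phase n lam \<kappa> p q r (t(j := z))) has_field_derivative
           - (1 / \<kappa>) * bethe_lhs n lam (with_base t) j) (at (t j))"
proof -
  \<comment> \<open>\<open>\<delta> i\<close> is the partial derivative of the i-th coordinate with
    respect to the j-th.\<close>
  define \<delta> :: "nat \<Rightarrow> complex" where "\<delta> i = (if i = j then 1 else 0)" for i
  have c: "((\<lambda>z. (t(j := z)) i) has_field_derivative \<delta> i) (at (t j))" for i
    by (cases "i = j") (auto simp: \<delta>_def)
  note b = b[unfolded phase_branch_at_def]
  have P: "((\<lambda>z. p (1 - (t(j := z)) 1)) has_field_derivative (0 - \<delta> 1) / (1 - t 1)) (at (t j))"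
  proof (rule log_branch_compose_derivative[where f = "\<lambda>z. 1 - (t(j := z)) 1"])
    show "log_branch_at (1 - t 1) p"
      using b by blast
    show "((\<lambda>z. 1 - (t(j := z)) 1) has_field_derivative 0 - \<delta> 1) (at (t j))"
      by (intro DERIV_diff DERIV_const c)
  qed simp
  have Q: "((\<lambda>z. q i ((t(j := z)) i)) has_field_derivative \<delta> i / t i) (at (t j))"
    if "i \<in> {1..n}" for i
    by (rule log_branch_compose_derivative[where f = "\<lambda>z. (t(j := z)) i"])
      (use b c that in auto)
  have R: "((\<lambda>z. r i ((t(j := z)) i - (t(j := z)) (i - 1))) has_field_derivative
      (\<delta> i - \<delta> (i - 1)) / (t i - t (i - 1))) (at (t j))"
    if "i \<in> {2..n}" for i
    by (rule log_branch_compose_derivative[where f = "\<lambda>z. (t(j := z)) i - (t(j := z)) (i - 1)"])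
      (use b that in \<open>auto intro!: DERIV_diff c simp del: fun_upd_apply\<close>)
  have D: "((\<lambda>z. ln_phase n lam \<kappa> p q r (t(j := z))) has_field_derivative
      - (1 / \<kappa>) * ((0 - \<delta> 1) / (1 - t 1) + (\<Sum>i=1..n. lam i * (\<delta> i / t i)) +
        (\<Sum>i=2..n. (\<delta> i - \<delta> (i - 1)) / (t i - t (i - 1))))) (at (t j))"
    unfolding ln_phase_def by (intro DERIV_cmult DERIV_add DERIV_sum P Q R)
  have "(\<Sum>i=1..n. lam i * (\<delta> i / t i)) = (\<Sum>i=1..n. if i = j then lam i / t i else 0)"
    by (rule sum.cong) (auto simp: \<delta>_def)
  then have S1: "(\<Sum>i=1..n. lam i * (\<delta> i / t i)) = lam j / t j"
    using j by simp
  \<comment> \<open>The variable \<open>t j\<close> enters only the differences with index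
    \<open>j\<close> and \<open>Suc j\<close>, with opposite signs.\<close>
  have "(\<Sum>i=2..n. (\<delta> i - \<delta> (i - 1)) / (t i - t (i - 1))) =
      (\<Sum>i=2..n. (if i = j then 1 / (t i - t (i - 1)) else 0) -
        (if i = Suc j then 1 / (t i - t (i - 1)) else 0))"
    by (rule sum.cong) (auto simp: \<delta>_def)
  also have "\<dots> = (if 2 \<le> j then 1 / (t j - t (j - 1)) else 0) -
      (if j < n then 1 / (t (Suc j) - t j) else 0)"
    using j by (auto simp: sum_subtractf)
  finally have S2: "(\<Sum>i=2..n. (\<delta> i - \<delta> (i - 1)) / (t i - t (i - 1))) = \<dots>" .
  \<comment> \<open>For \<open>j = 1\<close> the sum over differences has no term of index
    \<open>j\<close>; the factor \<open>1 - t 1\<close> supplies it. For larger \<open>j\<close>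
    that factor contributes nothing.\<close>
  have "(0 - \<delta> 1) / (1 - t 1) + (if 2 \<le> j then 1 / (t j - t (j - 1)) else 0) =
      1 / (with_base t j - with_base t (j - 1))"
  proof (cases "j = 1")
    case True
    have "- 1 / (1 - t 1) = 1 / (t 1 - 1)"
      by (metis minus_diff_eq minus_divide_left minus_divide_right)
    with True show ?thesis
      by (simp add: \<delta>_def with_base_def)
  next
    case False
    with j show ?thesis
      by (auto simp: \<delta>_def with_base_def)
  qed
  then have "(0 - \<delta> 1) / (1 - t 1) + (\<Sum>i=1..n. lam i * (\<delta> i / t i)) +
        (\<Sum>i=2..n. (\<delta> i - \<delta> (i - 1)) / (t i - t (i - 1))) = bethe_lhs n lam (with_base t) j"
    unfolding S1 S2 bethe_lhs_def using j by (auto simp: with_base_def algebra_simps)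
  with D show ?thesis
    by simp
qed

text \<open>All branches have the same partial derivatives, so quantifying over them changes
  nothing. \<open>phase_branch_exists\<close> rules out that the condition holds vacuously.\<close>

lemma phase_critical_point_iff_bethe:
  assumes "\<kappa> \<noteq> 0"
  shows "phase_critical_point n lam \<kappa> t \<longleftrightarrow>
    t \<in> phase_domain n \<and> (\<forall>j\<in>{1..n}. bethe_lhs n lam (with_base t) j = 0)"
proof -
  have "((\<lambda>z. ln_phase n lam \<kappa> p q r (t(j := z))) has_field_derivative 0) (at (t j)) \<longleftrightarrow>
      bethe_lhs n lam (with_base t) j = 0"
    if "phase_branch_at n p q r t" "j \<in> {1..n}" for p q r j
    using ln_phase_partial_derivative[OF that, of lam \<kappa>] assms
    by (auto dest: DERIV_unique)
  then show ?thesis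
    unfolding phase_critical_point_def using phase_branch_exists by blast
qed

lemma bethe_iff_ratio:
  assumes s: "\<And>j. j \<in> {1..n} \<Longrightarrow> s j = lam j + (if j < n then s (Suc j) + 1 else 0)"
    and nz: "\<And>j. j \<in> {1..n} \<Longrightarrow> T j \<noteq> 0"
    and ne: "\<And>j. j \<in> {1..n} \<Longrightarrow> T j \<noteq> T (j - 1)"
  shows "(\<forall>j\<in>{1..n}. bethe_lhs n lam T j = 0) \<longleftrightarrow>
    (\<forall>j\<in>{1..n}. T j * (s j + 1) = s j * T (j - 1))"
proof -
  define u where "u j = T j / (T j - T (j - 1))" for j
  have L: "bethe_lhs n lam T j = 0 \<longleftrightarrow> u j = (if j < n then u (Suc j) - 1 else 0) - lam j"
    if j: "j \<in> {1..n}" for j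
  proof -
    \<comment> \<open>This identity makes the system linear: the term coming from the next
      difference, once multiplied by \<open>T j\<close>, is a shift of the next unknown.\<close>
    have step: "u (Suc j) - 1 = T j / (T (Suc j) - T j)" if "j < n"
      using ne[of "Suc j"] that by (simp add: u_def field_simps)
    have "bethe_lhs n lam T j = 0 \<longleftrightarrow> T j * bethe_lhs n lam T j = 0"
      using nz[OF j] by simp
    also have "T j * bethe_lhs n lam T j = lam j + u j - (if j < n then u (Suc j) - 1 else 0)"
      using nz[OF j] step by (auto simp: bethe_lhs_def u_def algebra_simps)
    finally show ?thesis
      by (simp add: algebra_simps)
  qed
  have R: "T j * (s j + 1) = s j * T (j - 1) \<longleftrightarrow> u j = - s j" if j: "j \<in> {1..n}" for j
  proof -
    have "T j - T (j - 1) \<noteq> 0"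
      using ne[OF j] by simp
    then have "u j = - s j \<longleftrightarrow> T j = - s j * (T j - T (j - 1))"
      unfolding u_def by (rule nonzero_divide_eq_eq)
    also have "\<dots> \<longleftrightarrow> T j + s j * (T j - T (j - 1)) = 0"
      by (simp add: eq_neg_iff_add_eq_0)
    also have "\<dots> \<longleftrightarrow> T j * (s j + 1) - s j * T (j - 1) = 0"
      by (simp add: algebra_simps)
    finally show ?thesis
      by simp
  qed
  have "(\<forall>j\<in>{1..n}. u j = (if j < n then u (Suc j) - 1 else 0) - lam j) \<longleftrightarrow>
      (\<forall>j\<in>{1..n}. u j = - s j)"
  proof
    assume rec: "\<forall>j\<in>{1..n}. u j = (if j < n then u (Suc j) - 1 else 0) - lam j"
    \<comment> \<open>The induction descends from \<open>n\<close>. The guard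
      \<open>1 \<le> j\<close> is there because the recursion is available only on
      \<open>{1..n}\<close>.\<close>
    have "1 \<le> j \<longrightarrow> u j = - s j" if "j \<le> n" for j
      using that
    proof (induction rule: inc_induct)
      case base
      show ?case using rec s[of n] by auto
    next
      case (step j)
      show ?case using rec[rule_format, of j] s[of j] step by auto
    qed
    then show "\<forall>j\<in>{1..n}. u j = - s j" by simp
  next
    assume "\<forall>j\<in>{1..n}. u j = - s j"
    then show "\<forall>j\<in>{1..n}. u j = (if j < n then u (Suc j) - 1 else 0) - lam j"
      using s by auto
  qed
  with L R show ?thesis
    by simp
qed

lemma ratio_recursion_iff_prod:
  fixes T s :: "nat \<Rightarrow> 'a::field"
  assumes T0: "T 0 = 1" and s: "\<And>j. j \<in> {1..n} \<Longrightarrow> s j + 1 \<noteq> 0"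
  shows "(\<forall>j\<in>{1..n}. T j * (s j + 1) = s j * T (j - 1)) \<longleftrightarrow>
    (\<forall>j\<in>{1..n}. T j = (\<Prod>i=1..j. s i / (s i + 1)))"
proof
  assume rec: "\<forall>j\<in>{1..n}. T j * (s j + 1) = s j * T (j - 1)"
  have "T j = (\<Prod>i=1..j. s i / (s i + 1))" if "j \<le> n" for j
    using that
  proof (induction j)
    case 0
    show ?case using T0 by simp
  next
    case (Suc j)
    have "T (Suc j) = s (Suc j) * T j / (s (Suc j) + 1)"
      using rec[rule_format, of "Suc j"] s[of "Suc j"] Suc.prems by (simp add: eq_divide_eq)
    with Suc show ?case by simp
  qed
  then show "\<forall>j\<in>{1..n}. T j = (\<Prod>i=1..j. s i / (s i + 1))" by simp
next
  assume prod: "\<forall>j\<in>{1..n}. T j = (\<Prod>i=1..j. s i / (s i + 1))"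
  \<comment> \<open>At \<open>j = 0\<close> the empty product agrees with \<open>T 0 = 1\<close>, so
    \<open>j = 1\<close> needs no separate treatment below.\<close>
  have P: "T j = (\<Prod>i=1..j. s i / (s i + 1))" if "j \<le> n" for j
    using that T0 prod by (cases j) auto
  show "\<forall>j\<in>{1..n}. T j * (s j + 1) = s j * T (j - 1)"
  proof
    fix j assume j: "j \<in> {1..n}"
    then obtain m where m: "j = Suc m"
      by (cases j) auto
    show "T j * (s j + 1) = s j * T (j - 1)"
      using P[of j] P[of m] s[OF j] j by (simp add: m)
  qed
qed

theorem theorem2:
  fixes n :: nat and \<Lambda> :: "nat \<Rightarrow> complex" and lam :: "nat \<Rightarrow> complex" and \<kappa> :: complex
  assumes "n \<ge> 1" and "\<kappa> \<noteq> 0"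
    and "sl_weight n \<Lambda>"
    and "\<And>i. i \<in> {1..n} \<Longrightarrow> lam i = weight_form n \<Lambda> (simple_root n i)"
    and "\<And>i. i \<in> {1..n} \<Longrightarrow> (\<Sum>k=i..n. lam k) + of_nat n - of_nat i \<noteq> 0"
    and "\<And>i. i \<in> {1..n} \<Longrightarrow> (\<Sum>k=i..n. lam k) + of_nat n - of_nat i + 1 \<noteq> 0"
  shows "{t. phase_critical_point n lam \<kappa> t} = {bethe_point n lam}"
proof -
  define s where "s i = (\<Sum>k=i..n. lam k) + of_nat n - of_nat i" for i
  have s0: "s i \<noteq> 0" and s1: "s i + 1 \<noteq> 0" if "i \<in> {1..n}" for i
    using assms(5,6)[OF that] by (simp_all add: s_def)
  \<comment> \<open>Going from \<open>Suc j\<close> down to \<open>j\<close> adds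
    \<open>lam j\<close> to the sum and raises \<open>n - j\<close> by one; at \<open>j = n\<close>
    only \<open>lam n\<close> remains.\<close>
  have srec: "s j = lam j + (if j < n then s (Suc j) + 1 else 0)" if "j \<in> {1..n}" for j
    using that sum.atLeast_Suc_atMost[of j n lam] by (auto simp: s_def)
  have ratio: "(\<forall>j\<in>{1..n}. bethe_lhs n lam (with_base t) j = 0) \<longleftrightarrow>
      (\<forall>j\<in>{1..n}. with_base t j * (s j + 1) = s j * with_base t (j - 1))"
    if "t \<in> phase_domain n" for t
  proof (rule bethe_iff_ratio[OF srec])
    fix j assume j: "j \<in> {1..n}"
    show "with_base t j \<noteq> 0"
      using that j by (auto simp: phase_domain_def with_base_def)
    show "with_base t j \<noteq> with_base t (j - 1)"
      using that j by (cases "j = 1") (auto simp: phase_domain_def with_base_def)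
  qed
  \<comment> \<open>Only extensionality of \<open>t\<close> is assumed, so this applies to
    \<open>bethe_point n lam\<close> before that point is known to lie in
    \<open>phase_domain n\<close>.\<close>
  have prod: "(\<forall>j\<in>{1..n}. with_base t j * (s j + 1) = s j * with_base t (j - 1)) \<longleftrightarrow>
      t = bethe_point n lam" if ext: "t \<in> extensional {1..n}" for t
  proof -
    have "(\<forall>j\<in>{1..n}. with_base t j * (s j + 1) = s j * with_base t (j - 1)) \<longleftrightarrow>
        (\<forall>j\<in>{1..n}. with_base t j = (\<Prod>i=1..j. s i / (s i + 1)))"
      by (rule ratio_recursion_iff_prod[OF _ s1]) (simp_all add: with_base_def)
    also have "\<dots> \<longleftrightarrow> (\<forall>j\<in>{1..n}. t j = bethe_point n lam j)"
      by (auto simp: with_base_def bethe_point_def s_def)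
    also have "\<dots> \<longleftrightarrow> t = bethe_point n lam"
      using extensionalityI[OF ext, of "bethe_point n lam"] by (auto simp: bethe_point_def)
    finally show ?thesis .
  qed
  define B where "B = with_base (bethe_point n lam)"
  have ext: "bethe_point n lam \<in> extensional {1..n}"
    by (simp add: bethe_point_def)
  have Bnz: "B j \<noteq> 0" if "j \<le> n" for j
  proof (cases "j = 0")
    case False
    then have "B j = (\<Prod>i=1..j. s i / (s i + 1))"
      using that by (simp add: B_def with_base_def bethe_point_def s_def)
    then show ?thesis
      using s0 s1 that by simp
  qed (simp add: B_def with_base_def)
  \<comment> \<open>If two neighbours coincided, the terms with \<open>s j\<close> would cancel in
    the ratio equation and leave \<open>B j = 0\<close>.\<close>
  have Bne: "B j \<noteq> B (j - 1)" if j: "j \<in> {1..n}" for j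
  proof
    assume "B j = B (j - 1)"
    moreover have "B j * (s j + 1) = s j * B (j - 1)"
      using prod[OF ext] j by (simp add: B_def)
    ultimately have "B j = 0"
      by (simp add: algebra_simps)
    with Bnz j show False by simp
  qed
  have dom: "bethe_point n lam \<in> phase_domain n"
    unfolding phase_domain_def
  proof (intro CollectI conjI ballI ext)
    show "bethe_point n lam 1 \<noteq> 1"
      using Bne[of 1] \<open>n \<ge> 1\<close> by (simp add: B_def with_base_def)
  next
    fix j assume "j \<in> {1..n}"
    then show "bethe_point n lam j \<noteq> 0"
      using Bnz[of j] by (simp add: B_def with_base_def)
  next
    fix j assume "j \<in> {2..n}"
    then show "bethe_point n lam j \<noteq> bethe_point n lam (j - 1)"
      using Bne[of j] by (simp add: B_def with_base_def)
  qed
  have "phase_critical_point n lam \<kappa> t \<longleftrightarrow> t = bethe_point n lam" for t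
  proof (cases "t \<in> phase_domain n")
    case True
    then have "t \<in> extensional {1..n}"
      by (simp add: phase_domain_def)
    then show ?thesis
      using phase_critical_point_iff_bethe[OF \<open>\<kappa> \<noteq> 0\<close>, of n lam t] True ratio[OF True] prod[of t]
      by simp
  next
    \<comment> \<open>Both sides fail here: a critical point lies in the domain by definition, and
      \<open>bethe_point n lam\<close> by \<open>dom\<close>.\<close>
    case False
    then show ?thesis
      using phase_critical_point_iff_bethe[OF \<open>\<kappa> \<noteq> 0\<close>, of n lam t] dom by auto
  qed
  then show ?thesis by blast
qed

end
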